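(* Let $n\ge 1$ be an integer, let $Q'_n(8,4)$ be the cylinder graph of the linear octagonal-quadrilateral network, built from $n$ octagons and $n$ quadrilaterals, and put $\mu=15+4\sqrt{14}$, $\nu=15-4\sqrt{14}$. Then $$Kf\big(Q'_n(8,4)\big)=\frac{32n^3-2n}{3}+\frac{36n^2\sqrt{14}}{7}\left(\frac{\mu^n-\nu^n}{\mu^n+\nu^n-2}\right).$$
   Context: The graph $Q'_n(8,4)$ is the simple undirected graph with $8n$ vertices $1,2,\dots,4n,1',2',\dots,(4n)'$ and the following $10n$ edges: the path edges $\{j,j+1\}$ and $\{j',(j+1)'\}$ for $1\le j\le 4n-1$; the rungs $\{j,j'\}$ for all $1\le j\le 4n$ with $j\equiv 0$ or $1 \pmod 4$; and the two untwisted closing edges $\{4n,1\}$ and $\{(4n)',1'\}$. (It is obtained from the linear chain of alternating octagons and quadrilaterals, consecutive ones sharing an edge, by identifying the two opposite end edges in order.) For a connected graph $G$, regard each edge as a unit resistor and let $r_{ij}$ be the resistance distance (effective resistance) between vertices $i$ and $j$. The Kirchhoff index is $Kf(G)=\sum_{i<j} r_{ij}$, the sum being over all unordered pairs of distinct vertices. *)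

theory Defs
  imports Complex_Main "Graph_Theory.Pair_Digraph"
begin

text \<open>
  Finite simple undirected graphs are symmetric loop-free digraphs without parallel arcs
  (locale \<^locale>\<open>pair_graph\<close>): an edge \<open>{u, v}\<close> is the pair of arcs \<open>(u, v)\<close>, \<open>(v, u)\<close>.
\<close>

section \<open>Resistance distance and Kirchhoff index\<close>

text \<open>
  Every edge is a unit resistor, so by Ohm's law the current from \<open>w\<close> to a neighbour \<open>x\<close> is
  \<open>f w - f x\<close>. Kirchhoff's current law then says that the net current leaving \<open>w\<close> is the
  external current supplied at \<open>w\<close>: one unit enters the network at \<open>u\<close> and leaves it at \<open>v\<close>.
\<close>

definition unit_current_potential ::
    "'a pair_pre_digraph \<Rightarrow> 'a \<Rightarrow> 'a \<Rightarrow> ('a \<Rightarrow> real) \<Rightarrow> bool" where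
  "unit_current_potential G u v f \<longleftrightarrow>
     (\<forall>w \<in> pverts G.
        (\<Sum>x | (w, x) \<in> parcs G. f w - f x) = of_bool (w = u) - of_bool (w = v))"

text \<open>
  On a finite connected graph the potential exists and is unique up to an additive constant,
  so the potential difference below is well defined.
\<close>

definition resistance_distance :: "'a pair_pre_digraph \<Rightarrow> 'a \<Rightarrow> 'a \<Rightarrow> real" where
  "resistance_distance G u v =
     (THE r. \<exists>f. unit_current_potential G u v f \<and> r = f u - f v)"

definition kirchhoff_index :: "'a::linorder pair_pre_digraph \<Rightarrow> real" where
  "kirchhoff_index G =
     (\<Sum>(i, j) \<in> {(i, j). i \<in> pverts G \<and> j \<in> pverts G \<and> i < j}. resistance_distance G i j)"

section \<open>The cylinder of the linear octagonal-quadrilateral network\<close>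

text \<open>
  The vertices are numbered \<open>1, \<dots>, 8n\<close>: for \<open>1 \<le> j \<le> 4n\<close> the unprimed vertex \<open>j\<close> is the
  number \<open>j\<close>, and the primed vertex \<open>j'\<close> is the number \<open>4n + j\<close>.
\<close>

definition primed :: "nat \<Rightarrow> nat \<Rightarrow> nat" where
  "primed n j = 4 * n + j"

definition oct_quad_cylinder_edges :: "nat \<Rightarrow> (nat \<times> nat) set" where
  "oct_quad_cylinder_edges n =
     {(j, j + 1) | j. 1 \<le> j \<and> j < 4 * n} \<union>
     {(primed n j, primed n (j + 1)) | j. 1 \<le> j \<and> j < 4 * n} \<union>
     {(j, primed n j) | j. 1 \<le> j \<and> j \<le> 4 * n \<and> (j mod 4 = 0 \<or> j mod 4 = 1)} \<union>
     {(4 * n, 1), (primed n (4 * n), primed n 1)}"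

definition oct_quad_cylinder :: "nat \<Rightarrow> nat pair_pre_digraph" where
  "oct_quad_cylinder n =
     \<lparr>pverts = {1..4 * n} \<union> primed n ` {1..4 * n},
      parcs = symcl (oct_quad_cylinder_edges n)\<rparr>"

lemma pair_graph_oct_quad_cylinder:
  assumes "n \<ge> 1"
  shows "pair_graph (oct_quad_cylinder n)"
proof -
  let ?G = "oct_quad_cylinder n"
  have sub: "oct_quad_cylinder_edges n \<subseteq> pverts ?G \<times> pverts ?G"
    using assms by (auto simp: oct_quad_cylinder_def oct_quad_cylinder_edges_def)
  then have wf: "parcs ?G \<subseteq> pverts ?G \<times> pverts ?G"
    by (auto simp: oct_quad_cylinder_def symcl_def)
  have fin: "finite (pverts ?G)"
    by (simp add: oct_quad_cylinder_def)
  have "finite (parcs ?G)"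
    using finite_subset[OF wf] fin by simp
  moreover have "fst e \<noteq> snd e" if "e \<in> parcs ?G" for e
    using that assms
    by (auto simp: oct_quad_cylinder_def oct_quad_cylinder_edges_def symcl_def primed_def)
  moreover have "sym (parcs ?G)"
    by (auto simp: oct_quad_cylinder_def symcl_def sym_def)
  ultimately show ?thesis
    using wf fin by unfold_locales (auto simp: symmetric_def)
qed

end

theory Submission
  imports Defs
begin

text \<open>
  A function \<open>H\<close> of two vertices whose columns satisfy \<open>L (H \<cdot> v) = \<delta>\<^sub>v - c\<close>, where \<open>L\<close> is the
  Laplacian of the graph and \<open>c\<close> a constant, produces every unit current as a difference of two
  columns. So the resistance distance is \<open>H u u + H v v - H u v - H v u\<close>, and summing over all pairs
  gives the number of vertices times the trace of \<open>H\<close>, minus the sum of its entries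
  (\<open>kirchhoff_index_generalized_inverse\<close>).

  The cylinder consists of two copies of a cycle with \<open>m = 4n\<close> columns, joined by rungs, and it is
  invariant under exchanging the copies. On functions that are equal on the two copies the rungs
  carry no current and \<open>L\<close> is the Laplacian of the cycle; on functions that change sign between the
  copies each rung adds \<open>2\<close> to the diagonal. If \<open>A\<close> and \<open>B\<close> invert these two operators on the cycle
  (the first one up to a constant), then \<open>(A + B) / 2\<close> within a copy and \<open>(A - B) / 2\<close> between the
  copies is a suitable \<open>H\<close>, and the Kirchhoff index becomes \<open>2m (tr A + tr B)\<close> minus twice the sum of
  the entries of \<open>A\<close>.

  For \<open>A\<close> the quadratic kernel \<open>(d\<^sup>2 / m - d) / 2\<close> of the distance \<open>d\<close> is available. It has trace \<open>0\<close>,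
  and its sum accounts for the polynomial term \<open>(32n\<^sup>3 - 2n) / 3\<close>. For \<open>B\<close> the coefficients
  \<open>4, 2, 2, 4\<close> repeat with period \<open>4\<close>, and the transfer matrix over one period has determinant \<open>1\<close> and
  trace \<open>30\<close>; its eigenvalues are \<open>\<mu>\<close> and \<open>\<nu>\<close>. The kernel \<open>B\<close> is therefore assembled from the two
  solutions that are multiplied by \<open>\<nu>\<close> and \<open>\<mu>\<close> in each period (\<open>floquet_kernel_equation\<close>). On the
  diagonal it is the product of these solutions times \<open>(1 + \<nu>\<^sup>n) / (1 - \<nu>\<^sup>n)\<close> over their Wronskian
  \<open>80 \<surd>14\<close>, and the product is periodic with sum \<open>720\<close> over a period, which gives the trace.
\<close>

section \<open>Resistance distances from a generalized inverse of the Laplacian\<close>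

definition net_current :: "'a pair_pre_digraph \<Rightarrow> ('a \<Rightarrow> real) \<Rightarrow> 'a \<Rightarrow> real" where
  "net_current G f w = (\<Sum>x | (w, x) \<in> parcs G. f w - f x)"

lemma net_current_diff: "net_current G (\<lambda>x. f x - g x) w = net_current G f w - net_current G g w"
  by (simp add: net_current_def sum_subtractf[symmetric] algebra_simps)

lemma unit_current_potential_iff_net_current:
  "unit_current_potential G u v f \<longleftrightarrow>
    (\<forall>w\<in>pverts G. net_current G f w = of_bool (w = u) - of_bool (w = v))"
  by (simp add: unit_current_potential_def net_current_def)

text \<open>
  The Laplacian is a symmetric matrix: as a sum over arcs, the only asymmetric term \<open>g w * f x\<close> is
  turned into \<open>g x * f w\<close> by reversing every arc.
\<close>

lemma net_current_self_adjoint: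
  assumes "pair_graph G"
  shows "(\<Sum>w\<in>pverts G. g w * net_current G f w) = (\<Sum>w\<in>pverts G. f w * net_current G g w)"
proof -
  interpret pair_graph G by fact
  have sums_over_arcs: "(\<Sum>w\<in>pverts G. h w * net_current G k w)
      = (\<Sum>(w, x)\<in>parcs G. h w * k w) - (\<Sum>(w, x)\<in>parcs G. h w * k x)" for h k
  proof -
    have arcs: "Sigma (pverts G) (\<lambda>w. {x. (w, x) \<in> parcs G}) = parcs G"
      using in_arcsD1 by auto
    have fin: "finite {x. (w, x) \<in> parcs G}" for w
      by (rule finite_subset[OF _ finite_imageI[OF pair_finite_arcs, of snd]]) force
    have "(\<Sum>w\<in>pverts G. h w * net_current G k w)
        = (\<Sum>w\<in>pverts G. \<Sum>x | (w, x) \<in> parcs G. h w * k w - h w * k x)"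
      by (simp add: net_current_def sum_distrib_left algebra_simps)
    also have "\<dots> = (\<Sum>(w, x)\<in>parcs G. h w * k w - h w * k x)"
      by (subst sum.Sigma) (auto simp: fin arcs)
    finally show ?thesis
      by (simp add: sum_subtractf[symmetric] case_prod_unfold)
  qed
  have rev: "(\<Sum>(w, x)\<in>parcs G. g w * f x) = (\<Sum>(w, x)\<in>parcs G. f w * g x)"
    by (rule sum.reindex_bij_witness[of _ prod.swap prod.swap])
      (auto simp: mult.commute intro: arcs_symmetric)
  show ?thesis
    unfolding sums_over_arcs rev by (simp add: mult.commute)
qed

text \<open>
  Reciprocity makes the potential difference independent of the chosen potential:
  pairing a function \<open>h\<close> with the current of a unit potential gives
  \<open>h u - h v\<close>, so for two unit potentials \<open>f\<close> and \<open>g\<close> self-adjointness equates \<open>f u - f v\<close> with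
  \<open>g u - g v\<close>.
\<close>

lemma resistance_distance_eq_potential_diff:
  assumes G: "pair_graph G" and u: "u \<in> pverts G" and v: "v \<in> pverts G"
    and f: "unit_current_potential G u v f"
  shows "resistance_distance G u v = f u - f v"
proof -
  interpret pair_graph G by fact
  have pairing: "(\<Sum>w\<in>pverts G. h w * net_current G g w) = h u - h v"
    if "unit_current_potential G u v g" for g h
  proof -
    have "(\<Sum>w\<in>pverts G. h w * net_current G g w)
        = (\<Sum>w\<in>pverts G. (if w = u then h w else 0) - (if w = v then h w else 0))"
      using that by (intro sum.cong) (auto simp: unit_current_potential_iff_net_current)
    then show ?thesis
      using u v by (simp add: sum_subtractf)
  qed
  have "g u - g v = f u - f v" if g: "unit_current_potential G u v g" for g
    using net_current_self_adjoint[OF G, of g f] pairing[OF f, of g] pairing[OF g, of f] by simp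
  then show ?thesis
    unfolding resistance_distance_def using f by (intro the_equality) blast+
qed

text \<open>
  The constant \<open>c\<close> cancels in the difference of the columns \<open>u\<close> and \<open>v\<close>, which is therefore a unit
  potential.
\<close>

lemma resistance_distance_generalized_inverse:
  fixes H :: "'a \<Rightarrow> 'a \<Rightarrow> real"
  assumes G: "pair_graph G"
    and H: "\<And>v w. v \<in> pverts G \<Longrightarrow> w \<in> pverts G \<Longrightarrow> net_current G (\<lambda>x. H x v) w = of_bool (w = v) - c"
    and u: "u \<in> pverts G" and v: "v \<in> pverts G"
  shows "resistance_distance G u v = H u u + H v v - H u v - H v u"
proof -
  have "unit_current_potential G u v (\<lambda>x. H x u - H x v)"
    using H u v by (simp add: unit_current_potential_iff_net_current net_current_diff)
  from resistance_distance_eq_potential_diff[OF G u v this] show ?thesis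
    by simp
qed

lemma sum_ordered_pairs_symmetric:
  fixes R :: "'a::linorder \<Rightarrow> 'a \<Rightarrow> real"
  assumes V: "finite V" and sym: "\<And>i j. R i j = R j i" and diag: "\<And>i. R i i = 0"
  shows "2 * (\<Sum>(i, j)\<in>{(i, j). i \<in> V \<and> j \<in> V \<and> i < j}. R i j) = (\<Sum>i\<in>V. \<Sum>j\<in>V. R i j)"
proof -
  let ?U = "{(i, j). i \<in> V \<and> j \<in> V \<and> i < j}"
  let ?L = "{(i, j). i \<in> V \<and> j \<in> V \<and> j < i}"
  have fin: "finite ?U" "finite ?L"
    by (auto intro: finite_subset[of _ "V \<times> V"] simp: V)
  have "(\<Sum>i\<in>V. \<Sum>j\<in>V. R i j) = (\<Sum>(i, j)\<in>V \<times> V. R i j)"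
    by (simp add: sum.cartesian_product)
  also have "\<dots> = (\<Sum>(i, j)\<in>?U \<union> ?L. R i j)"
    by (rule sum.mono_neutral_right) (use V diag in \<open>auto, metis linorder_cases\<close>)
  also have "\<dots> = (\<Sum>(i, j)\<in>?U. R i j) + (\<Sum>(i, j)\<in>?L. R i j)"
    by (rule sum.union_disjoint) (use fin in auto)
  also have "(\<Sum>(i, j)\<in>?L. R i j) = (\<Sum>(i, j)\<in>?U. R i j)"
    by (rule sum.reindex_bij_witness[of _ prod.swap prod.swap]) (auto intro: sym)
  finally show ?thesis
    by simp
qed

lemma kirchhoff_index_generalized_inverse:
  fixes H :: "'a::linorder \<Rightarrow> 'a \<Rightarrow> real"
  assumes G: "pair_graph G"
    and H: "\<And>v w. v \<in> pverts G \<Longrightarrow> w \<in> pverts G \<Longrightarrow> net_current G (\<lambda>x. H x v) w = of_bool (w = v) - c"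
  shows "kirchhoff_index G
    = card (pverts G) * (\<Sum>v\<in>pverts G. H v v) - (\<Sum>u\<in>pverts G. \<Sum>v\<in>pverts G. H u v)"
proof -
  interpret pair_graph G by fact
  let ?V = "pverts G"
  let ?R = "\<lambda>u v. H u u + H v v - H u v - H v u"
  have "kirchhoff_index G = (\<Sum>(u, v)\<in>{(i, j). i \<in> ?V \<and> j \<in> ?V \<and> i < j}. ?R u v)"
    unfolding kirchhoff_index_def
    by (intro sum.cong) (auto simp: resistance_distance_generalized_inverse[OF G H])
  then have "2 * kirchhoff_index G = (\<Sum>u\<in>?V. \<Sum>v\<in>?V. ?R u v)"
    using sum_ordered_pairs_symmetric[of ?V ?R] pair_finite_verts by simp
  also have "\<dots> = 2 * (card ?V * (\<Sum>v\<in>?V. H v v) - (\<Sum>u\<in>?V. \<Sum>v\<in>?V. H u v))"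
    using sum.swap[of "\<lambda>u v. H v u" ?V ?V]
    by (simp add: sum.distrib sum_subtractf sum_distrib_left[symmetric])
  finally show ?thesis
    by simp
qed

section \<open>Green kernels on a cycle\<close>

definition cyc_suc :: "nat \<Rightarrow> nat \<Rightarrow> nat" where
  "cyc_suc m i = (if i = m then 1 else i + 1)"

definition cyc_pred :: "nat \<Rightarrow> nat \<Rightarrow> nat" where
  "cyc_pred m i = (if i = 1 then m else i - 1)"

text \<open>
  Green function of the cycle: away from the source the second difference of the quadratic term
  supplies the constant \<open>-1 / m\<close>, and the kink of the linear term at distance \<open>0\<close> supplies the source.
\<close>

definition cycle_kernel :: "nat \<Rightarrow> nat \<Rightarrow> nat \<Rightarrow> real" where
  "cycle_kernel m i j = (\<bar>real i - real j\<bar>\<^sup>2 / m - \<bar>real i - real j\<bar>) / 2"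

lemma cycle_kernel_equation:
  assumes "i \<in> {1..m}" "j \<in> {1..m}"
  shows "2 * cycle_kernel m i j - cycle_kernel m (cyc_suc m i) j - cycle_kernel m (cyc_pred m i) j
    = of_bool (i = j) - 1 / m"
proof -
  have m: "real m \<noteq> 0"
    using assms by auto
  \<comment> \<open>The kernel is unchanged under \<open>d \<mapsto> m - d\<close>, so the column \<open>m + 1\<close> may stand for \<open>1\<close>, and \<open>0\<close> for \<open>m\<close>.\<close>
  have suc: "cycle_kernel m (cyc_suc m i) j = cycle_kernel m (i + 1) j"
    using assms by (auto simp: cycle_kernel_def cyc_suc_def field_simps power2_eq_square)
  have pred: "cycle_kernel m (cyc_pred m i) j = cycle_kernel m (i - 1) j"
    using assms by (auto simp: cycle_kernel_def cyc_pred_def field_simps power2_eq_square)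
  consider "i < j" | "i = j" | "j < i"
    by linarith
  then show ?thesis
    using assms m unfolding suc pred
    by cases (auto simp: cycle_kernel_def of_nat_diff field_simps power2_eq_square)
qed

text \<open>
  All rows of a circulant kernel have the same sum. Moving from row \<open>i\<close> to row \<open>i + 1\<close> removes the
  distance \<open>m - i\<close> and adds the distance \<open>i\<close>, and \<open>g\<close> takes the same value at both.
\<close>

lemma sum_reflected_distance:
  fixes g :: "nat \<Rightarrow> real"
  assumes g: "\<And>d. d \<le> m \<Longrightarrow> g (m - d) = g d" and "i \<le> m"
  shows "(\<Sum>j = 1..m. g (nat \<bar>int i - int j\<bar>)) = (\<Sum>d = 1..m. g d)"
  using \<open>i \<le> m\<close>
proof (induction i)
  case 0
  then show ?case by simp
next
  case (Suc i)
  obtain k where k: "m = Suc k"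
    using Suc.prems by (cases m) auto
  have "(\<Sum>j = 1..m. g (nat \<bar>int (Suc i) - int j\<bar>)) = (\<Sum>j = 0..k. g (nat \<bar>int i - int j\<bar>))"
    using sum.shift_bounds_cl_Suc_ivl[of "\<lambda>j. g (nat \<bar>int (Suc i) - int j\<bar>)" 0 k]
    by (simp add: k del: sum.cl_ivl_Suc)
  also have "\<dots> = g i + (\<Sum>j = 1..k. g (nat \<bar>int i - int j\<bar>))"
    by (simp add: sum.atLeast_Suc_atMost)
  also have "g i = g (nat \<bar>int i - int m\<bar>)"
  proof -
    have "nat \<bar>int i - int m\<bar> = m - i"
      using Suc.prems by linarith
    then show ?thesis
      using g[of i] Suc.prems by simp
  qed
  also have "g (nat \<bar>int i - int m\<bar>) + (\<Sum>j = 1..k. g (nat \<bar>int i - int j\<bar>))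
      = (\<Sum>j = 1..m. g (nat \<bar>int i - int j\<bar>))"
    unfolding k by simp
  finally show ?case
    using Suc by simp
qed

lemma sum_cycle_kernel:
  assumes "m > 0"
  shows "(\<Sum>i = 1..m. \<Sum>j = 1..m. cycle_kernel m i j) = - (real m * (real m ^ 2 - 1) / 12)"
proof -
  define g where "g d = (real d ^ 2 / m - d) / 2" for d
  have "(\<Sum>j = 1..m. cycle_kernel m i j) = (\<Sum>d = 1..m. g d)" if "i \<in> {1..m}" for i
  proof -
    have "cycle_kernel m i j = g (nat \<bar>int i - int j\<bar>)" for j
      by (simp add: cycle_kernel_def g_def)
    moreover have "g (m - d) = g d" if "d \<le> m" for d
      using that assms by (simp add: g_def of_nat_diff field_simps power2_eq_square)
    ultimately show ?thesis
      using sum_reflected_distance[of m g i] that by simp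
  qed
  moreover have "(\<Sum>d = 1..k. g d) = (real k * (k + 1) * (2 * k + 1) / (6 * m) - real k * (k + 1) / 2) / 2" for k
  proof (induction k)
    case 0
    then show ?case by simp
  next
    case (Suc k)
    have "(\<Sum>d = 1..Suc k. g d)
        = (real k * (k + 1) * (2 * k + 1) / (6 * m) - real k * (k + 1) / 2) / 2 + g (Suc k)"
      using Suc by simp
    also have "\<dots> = (real (Suc k) * (Suc k + 1) * (2 * Suc k + 1) / (6 * m) - real (Suc k) * (Suc k + 1) / 2) / 2"
      using assms by (simp add: g_def field_simps power2_eq_square)
    finally show ?case .
  qed
  ultimately have "(\<Sum>i = 1..m. \<Sum>j = 1..m. cycle_kernel m i j)
      = m * ((real m * (m + 1) * (2 * m + 1) / (6 * m) - real m * (m + 1) / 2) / 2)"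
    by simp
  also have "\<dots> = - (real m * (real m ^ 2 - 1) / 12)"
    using assms by (simp add: field_simps power2_eq_square)
  finally show ?thesis .
qed

lemma wronskian_constant:
  fixes p q :: "nat \<Rightarrow> 'a::comm_ring_1"
  assumes "\<And>i. p i + p (i + 2) = a (i + 1) * p (i + 1)"
    and "\<And>i. q i + q (i + 2) = a (i + 1) * q (i + 1)"
  shows "p i * q (i + 1) - p (i + 1) * q i = p 0 * q 1 - p 1 * q 0"
proof (induction i)
  case 0
  then show ?case by simp
next
  case (Suc i)
  have rec: "p (Suc i + 1) = a (i + 1) * p (Suc i) - p i" "q (Suc i + 1) = a (i + 1) * q (Suc i) - q i"
    using assms[of i] by (simp_all add: eq_diff_eq add.commute)
  have "p (Suc i) * q (Suc i + 1) - p (Suc i + 1) * q (Suc i)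
      = p i * q (i + 1) - p (i + 1) * q i"
    unfolding rec by (simp add: algebra_simps)
  then show ?case
    using Suc by simp
qed

text \<open>
  Here \<open>p\<close> and \<open>q\<close> are solutions that are multiplied by \<open>\<rho>\<close> and \<open>1 / \<rho>\<close> when going once around the
  cycle. On the line the Green function is \<open>p (max i j) * q (min i j)\<close> divided by the Wronskian.
  Summing it over all translates of \<open>i\<close> by multiples of the circumference gives two geometric series
  with ratio \<open>\<rho>\<close>, for the translates beyond and before \<open>j\<close>: hence the two terms and the factor
  \<open>1 - \<rho>\<close>.
\<close>

definition floquet_kernel ::
    "(nat \<Rightarrow> real) \<Rightarrow> (nat \<Rightarrow> real) \<Rightarrow> real \<Rightarrow> nat \<Rightarrow> nat \<Rightarrow> real" where
  "floquet_kernel p q \<rho> i j =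
     (p (max i j) * q (min i j) + \<rho> * q (max i j) * p (min i j))
     / ((p 0 * q 1 - p 1 * q 0) * (1 - \<rho>))"

text \<open>
  Off the diagonal the kernel is a combination of the two solutions. At \<open>i = j\<close> the change of
  branch contributes the Wronskian, once with factor \<open>1\<close> and once with factor \<open>-\<rho>\<close>. The quasi-periodicity
  of \<open>p\<close> and \<open>q\<close> makes the two branches fit together where the cycle closes.
\<close>

lemma floquet_kernel_equation:
  fixes p q a :: "nat \<Rightarrow> real"
  assumes p: "\<And>i. p i + p (i + 2) = a (i + 1) * p (i + 1)"
    and q: "\<And>i. q i + q (i + 2) = a (i + 1) * q (i + 1)"
    and p_period: "\<And>i. p (i + m) = \<rho> * p i"
    and q_period: "\<And>i. q i = \<rho> * q (i + m)"
    and nz: "p 0 * q 1 - p 1 * q 0 \<noteq> 0" "\<rho> \<noteq> 1"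
    and i: "i \<in> {1..m}" and j: "j \<in> {1..m}"
  shows "a i * floquet_kernel p q \<rho> i j - floquet_kernel p q \<rho> (cyc_suc m i) j
      - floquet_kernel p q \<rho> (cyc_pred m i) j = of_bool (i = j)"
proof -
  let ?W = "p 0 * q 1 - p 1 * q 0"
  define D where "D = ?W * (1 - \<rho>)"
  define N where "N x = p (max x j) * q (min x j) + \<rho> * q (max x j) * p (min x j)" for x
  have kernel: "floquet_kernel p q \<rho> x j = N x / D" for x
    by (simp add: floquet_kernel_def N_def D_def)
  obtain k where k: "i = k + 1"
    using i by (metis add.commute atLeastAtMost_iff le_Suc_ex)
  have suc: "N (cyc_suc m i) = N (k + 2)"
    using j k p_period[of 1] q_period[of 1]
    by (auto simp: N_def cyc_suc_def max_def min_def algebra_simps)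
  have pred: "N (cyc_pred m i) = N k"
    using j k p_period[of 0] q_period[of 0]
    by (auto simp: N_def cyc_pred_def max_def min_def algebra_simps)
  have rec: "p (k + 2) = a (k + 1) * p (k + 1) - p k" "q (k + 2) = a (k + 1) * q (k + 1) - q k"
    using p[of k] q[of k] by (simp_all add: eq_diff_eq add.commute)
  have "a i * N i - N (k + 2) - N k = of_bool (i = j) * D"
  proof -
    consider "i < j" | "i = j" | "j < i"
      by linarith
    then show ?thesis
    proof cases
      case 1
      then have "N i = p j * q (k + 1) + \<rho> * q j * p (k + 1)"
        "N (k + 2) = p j * q (k + 2) + \<rho> * q j * p (k + 2)" "N k = p j * q k + \<rho> * q j * p k"
        by (simp_all add: N_def k max_def min_def)
      then show ?thesis
        using 1 k unfolding rec by (simp add: algebra_simps)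
    next
      case 2
      then have "N i = p (k + 1) * q (k + 1) + \<rho> * q (k + 1) * p (k + 1)"
        "N (k + 2) = p (k + 2) * q (k + 1) + \<rho> * q (k + 2) * p (k + 1)"
        "N k = p (k + 1) * q k + \<rho> * q (k + 1) * p k"
        using k by (auto simp: N_def max_def min_def)
      then have "a i * N i - N (k + 2) - N k = (p k * q (k + 1) - p (k + 1) * q k) * (1 - \<rho>)"
        unfolding rec k by (simp add: algebra_simps)
      then show ?thesis
        using 2 wronskian_constant[of p a q k, OF p q] by (simp add: D_def)
    next
      case 3
      then have "N i = p (k + 1) * q j + \<rho> * q (k + 1) * p j"
        "N (k + 2) = p (k + 2) * q j + \<rho> * q (k + 2) * p j" "N k = p k * q j + \<rho> * q k * p j"
        using k by (cases "j = k"; simp add: N_def max_def min_def)+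
      then show ?thesis
        using 3 k unfolding rec by (simp add: algebra_simps)
    qed
  qed
  moreover have "D \<noteq> 0"
    using nz by (simp add: D_def)
  ultimately show ?thesis
    unfolding kernel suc pred by (simp add: diff_divide_distrib[symmetric])
qed

section \<open>The antisymmetric potentials of the cylinder\<close>

definition rung :: "nat \<Rightarrow> bool" where
  "rung j \<longleftrightarrow> j mod 4 = 0 \<or> j mod 4 = 1"

text \<open>
  The solution with multiplier \<open>\<zeta>\<close> per period of four columns. There are no rungs at the columns
  \<open>2\<close> and \<open>3\<close>, so the solution is affine along the side \<open>1, 2, 3, 4\<close> of an octagon, where it runs from
  \<open>\<zeta> + 3\<close> to \<open>10 \<zeta>\<close>. The value at the column \<open>0\<close> is the latter divided by \<open>\<zeta>\<close>, written
  out separately to keep the exponent a natural number.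
\<close>

definition floquet :: "real \<Rightarrow> nat \<Rightarrow> real" where
  "floquet \<zeta> j = \<zeta> ^ (j div 4) *
     (if j mod 4 = 0 then 10 else (3 * real (j mod 4) - 2) * \<zeta> + 4 - real (j mod 4))"

lemma mod_4_cases:
  fixes j :: nat
  obtains t where "j = 4 * t" | t where "j = 4 * t + 1" | t where "j = 4 * t + 2" | t where "j = 4 * t + 3"
proof -
  have "j mod 4 < 4" and "4 * (j div 4) + j mod 4 = j"
    by simp_all
  then have "j = 4 * (j div 4) \<or> j = 4 * (j div 4) + 1 \<or> j = 4 * (j div 4) + 2 \<or> j = 4 * (j div 4) + 3"
    by linarith
  then show thesis
    using that by blast
qed

lemma floquet_block:
  "floquet \<zeta> (4 * t) = \<zeta> ^ t * 10"
  "floquet \<zeta> (4 * t + 1) = \<zeta> ^ t * (\<zeta> + 3)"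
  "floquet \<zeta> (4 * t + 2) = \<zeta> ^ t * (4 * \<zeta> + 2)"
  "floquet \<zeta> (4 * t + 3) = \<zeta> ^ t * (7 * \<zeta> + 1)"
proof -
  have "(4 * t + r) div 4 = t" "(4 * t + r) mod 4 = r" if "r < 4" for r
    using that by simp_all
  note div_mod = this[of 1, simplified] this[of 2, simplified] this[of 3, simplified]
  show "floquet \<zeta> (4 * t) = \<zeta> ^ t * 10"
    "floquet \<zeta> (4 * t + 1) = \<zeta> ^ t * (\<zeta> + 3)"
    "floquet \<zeta> (4 * t + 2) = \<zeta> ^ t * (4 * \<zeta> + 2)"
    "floquet \<zeta> (4 * t + 3) = \<zeta> ^ t * (7 * \<zeta> + 1)"
    by (simp_all add: floquet_def div_mod)
qed

text \<open>
  Only the step to the first column of the next octagon uses the equation for \<open>\<zeta>\<close>, which is the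
  characteristic equation of the transfer matrix over a period.
\<close>

lemma floquet_recurrence:
  assumes "\<zeta>\<^sup>2 = 30 * \<zeta> - 1"
  shows "floquet \<zeta> j + floquet \<zeta> (j + 2) = (2 + 2 * of_bool (rung (j + 1))) * floquet \<zeta> (j + 1)"
proof -
  show ?thesis
  proof (cases j rule: mod_4_cases)
    case (1 t)
    then have "j + 2 = 4 * t + 2" "j + 1 = 4 * t + 1" "rung (j + 1)"
      by (simp_all add: rung_def)
    then show ?thesis
      unfolding 1 by (simp only: floquet_block) (simp add: algebra_simps)
  next
    case (2 t)
    then have "j + 2 = 4 * t + 3" "j + 1 = 4 * t + 2" "\<not> rung (j + 1)"
      by (simp_all add: rung_def mod_Suc)
    then show ?thesis
      unfolding 2 by (simp only: floquet_block) (simp add: algebra_simps)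
  next
    case (3 t)
    then have "j + 2 = 4 * (t + 1)" "j + 1 = 4 * t + 3" "\<not> rung (j + 1)"
      by (simp_all add: rung_def mod_Suc)
    then show ?thesis
      unfolding 3 by (simp only: floquet_block) (simp add: algebra_simps)
  next
    case (4 t)
    then have "j + 2 = 4 * (t + 1) + 1" "j + 1 = 4 * (t + 1)" "rung (j + 1)"
      by (simp_all add: rung_def)
    moreover have "\<zeta> ^ t * \<zeta>\<^sup>2 = \<zeta> ^ t * (30 * \<zeta> - 1)"
      using assms by simp
    ultimately show ?thesis
      unfolding 4 by (simp only: floquet_block) (simp add: algebra_simps power2_eq_square)
  qed
qed

lemma floquet_period: "floquet \<zeta> (j + 4 * n) = \<zeta> ^ n * floquet \<zeta> j"
  by (simp add: floquet_def power_add)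

text \<open>
  As \<open>\<mu> * \<nu> = 1\<close>, the powers cancel and the product of the two solutions depends only on the column
  modulo \<open>4\<close>.
\<close>

lemma sum_floquet_products:
  assumes "\<mu> + \<nu> = 30" "\<mu> * \<nu> = 1"
  shows "(\<Sum>j = 1..4 * n. floquet \<nu> j * floquet \<mu> j) = 720 * real n"
proof -
  have products: "floquet \<nu> j * floquet \<mu> j = (if rung j then 100 else 260)" for j
  proof -
    have pow: "\<nu> ^ t * \<mu> ^ t = 1" for t
      using assms(2) by (metis mult.commute power_mult_distrib power_one)
    have lin: "(\<nu> ^ t * (b * \<nu> + c)) * (\<mu> ^ t * (b * \<mu> + c)) = b\<^sup>2 + 30 * b * c + c\<^sup>2" for b c t
    proof -
      have "(\<nu> ^ t * (b * \<nu> + c)) * (\<mu> ^ t * (b * \<mu> + c))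
          = (\<nu> ^ t * \<mu> ^ t) * (b\<^sup>2 * (\<mu> * \<nu>) + b * c * (\<mu> + \<nu>) + c\<^sup>2)"
        by (simp add: algebra_simps power2_eq_square)
      then show ?thesis
        by (simp add: pow assms)
    qed
    show ?thesis
    proof (cases j rule: mod_4_cases)
      case (1 t)
      then show ?thesis
        using lin[of t 0 10] by (simp add: floquet_block rung_def)
    next
      case (2 t)
      then show ?thesis
        using lin[of t 1 3] floquet_block(2)[of _ t] by (simp add: rung_def)
    next
      case (3 t)
      then show ?thesis
        using lin[of t 4 2] floquet_block(3)[of _ t] by (simp add: rung_def mod_Suc)
    next
      case (4 t)
      then show ?thesis
        using lin[of t 7 1] floquet_block(4)[of _ t] by (simp add: rung_def mod_Suc)
    qed
  qed
  have "(\<Sum>j = 1..4 * n. if rung j then 100 else 260) = 720 * real n"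
  proof (induction n)
    case 0
    then show ?case by simp
  next
    case (Suc n)
    have block: "4 * Suc n = Suc (Suc (Suc (Suc (4 * n))))"
      by simp
    show ?case
      using Suc unfolding block by (simp add: rung_def mod_Suc)
  qed
  then show ?thesis
    by (simp only: products)
qed

section \<open>A generalized inverse for the cylinder\<close>

text \<open>
  Each arc of the chosen orientation described by its two end numbers, without quantifiers: the
  neighbourhoods are then determined by linear arithmetic, with \<open>rung\<close> opaque.
\<close>

lemma oct_quad_cylinder_edges_iff:
  "(u, x) \<in> oct_quad_cylinder_edges n \<longleftrightarrow>
    1 \<le> u \<and> u < 4 * n \<and> x = u + 1 \<or> 4 * n < u \<and> u < 8 * n \<and> x = u + 1 \<or>
    1 \<le> u \<and> u \<le> 4 * n \<and> rung u \<and> x = 4 * n + u \<or>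
    u = 4 * n \<and> x = 1 \<or> u = 8 * n \<and> x = 4 * n + 1"
proof -
  have "(\<exists>j. u = 4 * n + j \<and> x = 4 * n + (j + 1) \<and> 1 \<le> j \<and> j < 4 * n) \<longleftrightarrow>
      4 * n < u \<and> u < 8 * n \<and> x = u + 1"
    by presburger
  then show ?thesis
    unfolding oct_quad_cylinder_edges_def rung_def[symmetric] primed_def
      Un_iff mem_Collect_eq prod.inject insert_iff empty_iff
    by auto
qed

lemma oct_quad_cylinder_edges_at:
  assumes j: "j \<in> {1..4 * n}"
  shows "(j, x) \<in> oct_quad_cylinder_edges n \<longleftrightarrow> j < 4 * n \<and> x = j + 1 \<or> rung j \<and> x = primed n j \<or> j = 4 * n \<and> x = 1"
    and "(x, j) \<in> oct_quad_cylinder_edges n \<longleftrightarrow> 1 < j \<and> x = j - 1 \<or> j = 1 \<and> x = 4 * n"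
    and "(primed n j, x) \<in> oct_quad_cylinder_edges n \<longleftrightarrow>
      j < 4 * n \<and> x = primed n (j + 1) \<or> j = 4 * n \<and> x = primed n 1"
    and "(x, primed n j) \<in> oct_quad_cylinder_edges n \<longleftrightarrow>
      1 < j \<and> x = primed n (j - 1) \<or> rung j \<and> x = j \<or> j = 1 \<and> x = primed n (4 * n)"
  subgoal unfolding oct_quad_cylinder_edges_iff primed_def using j by auto
  subgoal unfolding oct_quad_cylinder_edges_iff primed_def using j by (cases "j = 1") auto
  subgoal unfolding oct_quad_cylinder_edges_iff primed_def using j by (cases "j = 4 * n") auto
  subgoal unfolding oct_quad_cylinder_edges_iff primed_def using j by (cases "j = 1"; cases "x \<le> 4 * n"; auto)
  done

lemma neighbours_oct_quad_cylinder:
  assumes j: "j \<in> {1..4 * n}"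
  shows "{x. (j, x) \<in> parcs (oct_quad_cylinder n)}
      = {cyc_suc (4 * n) j, cyc_pred (4 * n) j} \<union> (if rung j then {primed n j} else {})"
    and "{x. (primed n j, x) \<in> parcs (oct_quad_cylinder n)}
      = {primed n (cyc_suc (4 * n) j), primed n (cyc_pred (4 * n) j)} \<union> (if rung j then {j} else {})"
proof -
  have arc_iff: "(u, x) \<in> parcs (oct_quad_cylinder n) \<longleftrightarrow>
      (u, x) \<in> oct_quad_cylinder_edges n \<or> (x, u) \<in> oct_quad_cylinder_edges n" for u x
    by (auto simp: oct_quad_cylinder_def symcl_def)
  have suc: "(j < 4 * n \<and> x = f (j + 1) \<or> j = 4 * n \<and> x = f 1) \<longleftrightarrow> x = f (cyc_suc (4 * n) j)"
    and pred: "(1 < j \<and> x = f (j - 1) \<or> j = 1 \<and> x = f (4 * n)) \<longleftrightarrow> x = f (cyc_pred (4 * n) j)"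
    for x and f :: "nat \<Rightarrow> nat"
    using j by (auto simp: cyc_suc_def cyc_pred_def)
  show "{x. (j, x) \<in> parcs (oct_quad_cylinder n)}
      = {cyc_suc (4 * n) j, cyc_pred (4 * n) j} \<union> (if rung j then {primed n j} else {})"
    unfolding arc_iff oct_quad_cylinder_edges_at(1)[OF j] oct_quad_cylinder_edges_at(2)[OF j]
    using suc[of _ "\<lambda>x. x"] pred[of _ "\<lambda>x. x"] by (auto simp del: One_nat_def)
  show "{x. (primed n j, x) \<in> parcs (oct_quad_cylinder n)}
      = {primed n (cyc_suc (4 * n) j), primed n (cyc_pred (4 * n) j)} \<union> (if rung j then {j} else {})"
    unfolding arc_iff oct_quad_cylinder_edges_at(3)[OF j] oct_quad_cylinder_edges_at(4)[OF j]
    using suc[of _ "primed n"] pred[of _ "primed n"] by (auto simp del: One_nat_def)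
qed

lemma net_current_oct_quad_cylinder:
  assumes "n \<ge> 1" and j: "j \<in> {1..4 * n}"
  shows "net_current (oct_quad_cylinder n) f j
      = 2 * f j - f (cyc_suc (4 * n) j) - f (cyc_pred (4 * n) j)
        + of_bool (rung j) * (f j - f (primed n j))"
    and "net_current (oct_quad_cylinder n) f (primed n j)
      = 2 * f (primed n j) - f (primed n (cyc_suc (4 * n) j)) - f (primed n (cyc_pred (4 * n) j))
        + of_bool (rung j) * (f (primed n j) - f j)"
proof -
  have distinct: "cyc_suc (4 * n) j \<noteq> cyc_pred (4 * n) j"
    "primed n j \<notin> {cyc_suc (4 * n) j, cyc_pred (4 * n) j}"
    "j \<notin> {primed n (cyc_suc (4 * n) j), primed n (cyc_pred (4 * n) j)}"
    "primed n (cyc_suc (4 * n) j) \<noteq> primed n (cyc_pred (4 * n) j)"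
    using assms by (auto simp: cyc_suc_def cyc_pred_def primed_def) presburger+
  show "net_current (oct_quad_cylinder n) f j
      = 2 * f j - f (cyc_suc (4 * n) j) - f (cyc_pred (4 * n) j)
        + of_bool (rung j) * (f j - f (primed n j))"
    using distinct unfolding net_current_def neighbours_oct_quad_cylinder(1)[OF j] by auto
  show "net_current (oct_quad_cylinder n) f (primed n j)
      = 2 * f (primed n j) - f (primed n (cyc_suc (4 * n) j)) - f (primed n (cyc_pred (4 * n) j))
        + of_bool (rung j) * (f (primed n j) - f j)"
    using distinct unfolding net_current_def neighbours_oct_quad_cylinder(2)[OF j] by auto
qed

definition column :: "nat \<Rightarrow> nat \<Rightarrow> nat" where
  "column n v = (if v \<le> 4 * n then v else v - 4 * n)"

definition sheet_sign :: "nat \<Rightarrow> nat \<Rightarrow> real" where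
  "sheet_sign n v = (if v \<le> 4 * n then 1 else -1)"

lemma column_sheet_sign:
  assumes "j \<in> {1..4 * n}"
  shows "column n j = j" "column n (primed n j) = j"
    "sheet_sign n j = 1" "sheet_sign n (primed n j) = -1"
  using assms by (auto simp: column_def sheet_sign_def primed_def)

lemma pverts_oct_quad_cylinder_cases:
  assumes "v \<in> pverts (oct_quad_cylinder n)"
  obtains j where "j \<in> {1..4 * n}" "v = j" | j where "j \<in> {1..4 * n}" "v = primed n j"
  using assms by (auto simp: oct_quad_cylinder_def)

lemma sum_pverts_oct_quad_cylinder:
  "(\<Sum>v\<in>pverts (oct_quad_cylinder n). f v) = (\<Sum>j = 1..4 * n. f j + f (primed n j))"
proof -
  have inj: "inj_on (primed n) {1..4 * n}"
    by (auto simp: inj_on_def primed_def)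
  have "(\<Sum>v\<in>pverts (oct_quad_cylinder n). f v)
      = (\<Sum>j = 1..4 * n. f j) + (\<Sum>v\<in>primed n ` {1..4 * n}. f v)"
    unfolding oct_quad_cylinder_def pair_pre_digraph.simps
    by (rule sum.union_disjoint) (auto simp: primed_def)
  then show ?thesis
    unfolding sum.reindex[OF inj] comp_def sum.distrib .
qed

lemma cyc_neighbours_in_range:
  assumes "j \<in> {1..m}"
  shows "cyc_suc m j \<in> {1..m}" "cyc_pred m j \<in> {1..m}"
  using assms by (auto simp: cyc_suc_def cyc_pred_def)

text \<open>
  Each column of \<open>H\<close> splits into a part that is the same on both sheets, where the rungs carry no
  current, and a part that changes sign, where the potential drop along a rung is twice the value
  at its end. The two resulting sources \<open>\<delta> / 2\<close> add up on the sheet of \<open>v\<close> and cancel on the other one.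
\<close>

lemma two_sheet_generalized_inverse:
  fixes A B :: "nat \<Rightarrow> nat \<Rightarrow> real" and n :: nat
  defines "H \<equiv> \<lambda>u v. (A (column n u) (column n v)
      + sheet_sign n u * sheet_sign n v * B (column n u) (column n v)) / 2"
  assumes n: "n \<ge> 1"
    and A: "\<And>i j. i \<in> {1..4 * n} \<Longrightarrow> j \<in> {1..4 * n} \<Longrightarrow>
      2 * A i j - A (cyc_suc (4 * n) i) j - A (cyc_pred (4 * n) i) j = of_bool (i = j) - c"
    and B: "\<And>i j. i \<in> {1..4 * n} \<Longrightarrow> j \<in> {1..4 * n} \<Longrightarrow>
      (2 + 2 * of_bool (rung i)) * B i j - B (cyc_suc (4 * n) i) j - B (cyc_pred (4 * n) i) j
        = of_bool (i = j)"
    and v: "v \<in> pverts (oct_quad_cylinder n)" and w: "w \<in> pverts (oct_quad_cylinder n)"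
  shows "net_current (oct_quad_cylinder n) (\<lambda>x. H x v) w = of_bool (w = v) - c / 2"
proof -
  have "net_current (oct_quad_cylinder n) (\<lambda>x. H x v) w
      = (of_bool (column n w = column n v) - c
        + sheet_sign n w * sheet_sign n v * of_bool (column n w = column n v)) / 2"
  proof -
    have j: "column n v \<in> {1..4 * n}"
      using v by (cases rule: pverts_oct_quad_cylinder_cases) (auto simp: column_sheet_sign)
    show ?thesis
      using w
    proof (cases rule: pverts_oct_quad_cylinder_cases)
      case (1 i)
      \<comment> \<open>Solved for \<open>c\<close>, the equation for \<open>A\<close> can be substituted together with the one for \<open>B\<close>.\<close>
      have c: "c = of_bool (i = column n v)
          - (2 * A i (column n v) - A (cyc_suc (4 * n) i) (column n v) - A (cyc_pred (4 * n) i) (column n v))"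
        using A[OF 1(1) j] by simp
      note range = 1(1) cyc_neighbours_in_range[OF 1(1)]
      show ?thesis
        unfolding 1(2) net_current_oct_quad_cylinder(1)[OF n 1(1)] H_def
          column_sheet_sign[OF range(1)] column_sheet_sign[OF range(2)] column_sheet_sign[OF range(3)]
          c B[OF 1(1) j, symmetric]
        by (cases "rung i") (simp_all add: field_simps)
    next
      case (2 i)
      have c: "c = of_bool (i = column n v)
          - (2 * A i (column n v) - A (cyc_suc (4 * n) i) (column n v) - A (cyc_pred (4 * n) i) (column n v))"
        using A[OF 2(1) j] by simp
      note range = 2(1) cyc_neighbours_in_range[OF 2(1)]
      show ?thesis
        unfolding 2(2) net_current_oct_quad_cylinder(2)[OF n 2(1)] H_def
          column_sheet_sign[OF range(1)] column_sheet_sign[OF range(2)] column_sheet_sign[OF range(3)]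
          c B[OF 2(1) j, symmetric]
        by (cases "rung i") (simp_all add: field_simps)
    qed
  qed
  also have "\<dots> = (of_bool (column n w = column n v) * (1 + sheet_sign n w * sheet_sign n v) - c) / 2"
    by (simp add: algebra_simps)
  also have "of_bool (column n w = column n v) * (1 + sheet_sign n w * sheet_sign n v)
      = 2 * (of_bool (w = v) :: real)"
    using v w by (auto simp: oct_quad_cylinder_def column_def sheet_sign_def primed_def)
  finally show ?thesis
    by (simp add: diff_divide_distrib)
qed

text \<open>
  In the sum of all entries of \<open>H\<close> the contributions \<open>\<plusminus>B\<close> of the two sheets cancel, while the diagonal
  of the cycle kernel vanishes: \<open>B\<close> enters only through its trace and the cycle kernel only through
  the sum of its entries.
\<close>

lemma kirchhoff_index_two_sheets:
  fixes B :: "nat \<Rightarrow> nat \<Rightarrow> real"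
  assumes n: "n \<ge> 1"
    and B: "\<And>i j. i \<in> {1..4 * n} \<Longrightarrow> j \<in> {1..4 * n} \<Longrightarrow>
      (2 + 2 * of_bool (rung i)) * B i j - B (cyc_suc (4 * n) i) j - B (cyc_pred (4 * n) i) j
        = of_bool (i = j)"
  shows "kirchhoff_index (oct_quad_cylinder n)
    = (32 * real n ^ 3 - 2 * real n) / 3 + 8 * real n * (\<Sum>j = 1..4 * n. B j j)"
proof -
  let ?G = "oct_quad_cylinder n" and ?A = "cycle_kernel (4 * n)"
  define H where "H u v = (?A (column n u) (column n v)
      + sheet_sign n u * sheet_sign n v * B (column n u) (column n v)) / 2" for u v
  have "net_current ?G (\<lambda>x. H x v) w = of_bool (w = v) - 1 / (4 * n) / 2"
    if "v \<in> pverts ?G" "w \<in> pverts ?G" for v w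
    unfolding H_def
    by (rule two_sheet_generalized_inverse[OF n _ B that]) (use cycle_kernel_equation[of _ "4 * n"] in auto)
  then have "kirchhoff_index ?G
      = card (pverts ?G) * (\<Sum>v\<in>pverts ?G. H v v) - (\<Sum>u\<in>pverts ?G. \<Sum>v\<in>pverts ?G. H u v)"
    by (rule kirchhoff_index_generalized_inverse[OF pair_graph_oct_quad_cylinder[OF n]])
  moreover have "card (pverts ?G) = 8 * n"
    using sum_pverts_oct_quad_cylinder[of "\<lambda>_. 1 :: nat" n] by simp
  moreover have "(\<Sum>v\<in>pverts ?G. H v v) = (\<Sum>j = 1..4 * n. B j j)"
    unfolding sum_pverts_oct_quad_cylinder
    by (intro sum.cong) (auto simp: H_def column_sheet_sign cycle_kernel_def)
  moreover have "(\<Sum>u\<in>pverts ?G. \<Sum>v\<in>pverts ?G. H u v) = (\<Sum>i = 1..4 * n. \<Sum>j = 1..4 * n. 2 * ?A i j)"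
    unfolding sum_pverts_oct_quad_cylinder sum.distrib[symmetric]
    by (intro sum.cong) (auto simp: H_def column_sheet_sign)
  moreover have "\<dots> = - (32 * real n ^ 3 - 2 * real n) / 3"
    using sum_cycle_kernel[of "4 * n"] n
    by (simp add: sum_distrib_left[symmetric] power2_eq_square power3_eq_cube field_simps)
  ultimately show ?thesis
    by simp
qed

theorem theorem3p3:
  fixes n :: nat and \<mu> \<nu> :: real
  assumes "n \<ge> 1"
    and "\<mu> = 15 + 4 * sqrt 14"
    and "\<nu> = 15 - 4 * sqrt 14"
  shows "kirchhoff_index (oct_quad_cylinder n) =
           (32 * real n ^ 3 - 2 * real n) / 3
           + 36 * real n ^ 2 * sqrt 14 / 7 * ((\<mu> ^ n - \<nu> ^ n) / (\<mu> ^ n + \<nu> ^ n - 2))"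
proof -
  have add: "\<mu> + \<nu> = 30" and mult: "\<mu> * \<nu> = 1"
    unfolding assms(2,3) by (simp_all add: algebra_simps)
  have char: "\<mu>\<^sup>2 = 30 * \<mu> - 1" "\<nu>\<^sup>2 = 30 * \<nu> - 1"
    unfolding assms(2,3) by (simp_all add: power2_eq_square algebra_simps)
  \<comment> \<open>The bounds \<open>7 / 2 < \<surd>14 < 15 / 4\<close> place \<open>\<nu>\<close> strictly between \<open>0\<close> and \<open>1\<close>.\<close>
  have "sqrt 14 < sqrt ((15 / 4)\<^sup>2)" "sqrt ((7 / 2)\<^sup>2) < sqrt 14"
    by (subst real_sqrt_less_iff, simp add: power2_eq_square)+
  then have \<nu>: "0 < \<nu>" "\<nu> < 1"
    using assms(3) by simp_all
  then have \<rho>: "\<nu> ^ n \<noteq> 1" "0 < \<nu> ^ n"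
    using assms(1) power_less_one_iff[of \<nu> n] by auto
  have inv: "\<mu> ^ n = 1 / \<nu> ^ n"
    using \<nu> power_mult_distrib[of \<mu> \<nu> n] by (simp add: mult eq_divide_eq)
  let ?p = "floquet \<nu>" and ?q = "floquet \<mu>"
  have W: "?p 0 * ?q 1 - ?p 1 * ?q 0 = 80 * sqrt 14"
    unfolding assms(2,3) by (simp add: floquet_def algebra_simps)
  define B where "B = floquet_kernel ?p ?q (\<nu> ^ n)"
  have period: "?q i = \<nu> ^ n * ?q (i + 4 * n)" for i
    using \<nu> by (simp add: floquet_period inv)
  have "(2 + 2 * of_bool (rung i)) * B i j - B (cyc_suc (4 * n) i) j - B (cyc_pred (4 * n) i) j
      = of_bool (i = j)" if "i \<in> {1..4 * n}" "j \<in> {1..4 * n}" for i j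
    unfolding B_def using that \<rho> W
    by (intro floquet_kernel_equation floquet_recurrence char floquet_period period) auto
  then have "kirchhoff_index (oct_quad_cylinder n)
      = (32 * real n ^ 3 - 2 * real n) / 3 + 8 * real n * (\<Sum>j = 1..4 * n. B j j)"
    by (rule kirchhoff_index_two_sheets[OF assms(1)])
  also have "(\<Sum>j = 1..4 * n. B j j)
      = (1 + \<nu> ^ n) * (\<Sum>j = 1..4 * n. ?p j * ?q j) / (80 * sqrt 14 * (1 - \<nu> ^ n))"
    unfolding B_def floquet_kernel_def W sum_distrib_left sum_divide_distrib
    by (simp add: algebra_simps)
  also have "\<dots> = 9 * real n / sqrt 14 * ((1 + \<nu> ^ n) / (1 - \<nu> ^ n))"
    unfolding sum_floquet_products[OF add mult] by (simp add: mult.commute)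
  \<comment> \<open>Multiply numerator and denominator by \<open>(1 - \<nu>\<^sup>n) / \<nu>\<^sup>n\<close>.\<close>
  also have "(1 + \<nu> ^ n) / (1 - \<nu> ^ n) = (\<mu> ^ n - \<nu> ^ n) / (\<mu> ^ n + \<nu> ^ n - 2)"
  proof -
    have expand: "1 / y - y = (1 + y) * ((1 - y) / y)" "1 / y + y - 2 = (1 - y) * ((1 - y) / y)"
      if "y \<noteq> 0" for y :: real
      using that by (simp_all add: field_simps)
    have "\<nu> ^ n \<noteq> 0" and "(1 - \<nu> ^ n) / \<nu> ^ n \<noteq> 0"
      using \<nu> \<rho> by simp_all
    then show ?thesis
      unfolding inv expand[OF \<open>\<nu> ^ n \<noteq> 0\<close>] by (subst mult_divide_mult_cancel_right) simp_all
  qed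
  also have "9 * real n / sqrt 14 = 9 * real n * sqrt 14 / 14"
    by (simp add: field_simps)
  also have "8 * real n * (9 * real n * sqrt 14 / 14 * c) = 36 * real n ^ 2 * sqrt 14 / 7 * c" for c
    by (simp add: power2_eq_square)
  finally show ?thesis .
qed

end
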